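(* Let $f,g\in\mathbb{R}[z_1,\ldots,z_n]$. Then $\alpha f+\beta g\in\mathcal{H}_n(\mathbb{R})\cup\{0\}$ for all $\alpha,\beta\in\mathbb{R}$ if and only if either $f\ll g$, or $g\ll f$, or $f=g\equiv 0$.
   Context: A polynomial $f\in\mathbb{C}[z_1,\ldots,z_n]$ is stable if $f(z_1,\ldots,z_n)\neq 0$ whenever $\operatorname{Im}(z_j)>0$ for all $1\le j\le n$; it is real stable if in addition it has real coefficients. $\mathcal{H}_n(\mathbb{C})$ and $\mathcal{H}_n(\mathbb{R})$ denote the sets of stable and real stable polynomials in $n$ variables. Two polynomials $f,g\in\mathbb{R}[z_1,\ldots,z_n]$ are in proper position, denoted $f\ll g$, if $g+if\in\mathcal{H}_n(\mathbb{C})$. *)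

theory Defs
  imports "HOL-Library.Poly_Mapping" "HOL-Analysis.Analysis"
begin

text \<open>
  Polynomials in finitely many variables indexed by a finite type \<open>'n\<close>, so that
  \<open>n = CARD('n)\<close>: a finitely supported coefficient function on exponent vectors
  \<open>'n \<Rightarrow>\<^sub>0 nat\<close>. Sum and product are the ring operations that
  \<^theory>\<open>HOL-Library.Poly_Mapping\<close> provides on this type.
\<close>

type_synonym ('n, 'a) mpoly = "('n \<Rightarrow>\<^sub>0 nat) \<Rightarrow>\<^sub>0 'a"

definition mpoly_const :: "'a::zero \<Rightarrow> ('n, 'a) mpoly" where
  "mpoly_const c = Poly_Mapping.single 0 c"

definition mpoly_eval :: "('n::finite, 'a::comm_semiring_1) mpoly \<Rightarrow> 'a ^ 'n \<Rightarrow> 'a" where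
  "mpoly_eval p z =
     (\<Sum>m\<in>Poly_Mapping.keys p. Poly_Mapping.lookup p m * (\<Prod>j\<in>UNIV. (z $ j) ^ Poly_Mapping.lookup m j))"

definition complex_mpoly :: "('n, real) mpoly \<Rightarrow> ('n, complex) mpoly" where
  "complex_mpoly p = Poly_Mapping.map complex_of_real p"

definition stable_mpolys :: "('n::finite, complex) mpoly set" where
  "stable_mpolys = {f. \<forall>z. (\<forall>j. Im (z $ j) > 0) \<longrightarrow> mpoly_eval f z \<noteq> 0}"

text \<open>
  Having real coefficients is expressed by the coefficient type; \<^const>\<open>complex_mpoly\<close> is the
  inclusion of the real into the complex polynomials.
\<close>

definition real_stable_mpolys :: "('n::finite, real) mpoly set" where
  "real_stable_mpolys = {f. complex_mpoly f \<in> stable_mpolys}"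

definition proper_position :: "('n::finite, real) mpoly \<Rightarrow> ('n, real) mpoly \<Rightarrow> bool"
    (infix \<open>\<lless>\<close> 50) where
  "f \<lless> g \<longleftrightarrow> complex_mpoly g + mpoly_const \<i> * complex_mpoly f \<in> stable_mpolys"

end

theory Submission
  imports
    Defs
    "HOL-Computational_Algebra.Fundamental_Theorem_Algebra"
    "HOL-Complex_Analysis.Conformal_Mappings"
begin

text \<open>
  On every real line \<open>t \<mapsto> x + t y\<close> with \<open>y > 0\<close> the stable polynomial \<open>h = g + i f\<close> has its roots in
  the closed lower half plane, so \<open>\<bar>h(cnj z)\<bar> \<le> \<bar>h(z)\<bar>\<close>, that is, \<open>\<bar>(g - i f) / (g + i f)\<bar> \<le> 1\<close> on the
  product of upper half planes. If a real combination of \<open>f\<close> and \<open>g\<close> vanishes at a point there, this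
  quotient has modulus \<open>1\<close> at that point; by the maximum modulus principle it is constant, and the
  combination vanishes identically.

  Conversely, if no nontrivial real combination is zero as a polynomial, then \<open>Im (g cnj f)\<close> has no
  zero on the product of upper half planes. This set is connected, so the sign is constant, and it decides
  between \<open>f \<lless> g\<close> and \<open>g \<lless> f\<close> because \<open>\<bar>g + i f\<bar>\<^sup>2 - \<bar>g - i f\<bar>\<^sup>2 = 4 Im (g cnj f)\<close>.
\<close>

section \<open>Evaluation of polynomials\<close>

lemma lookup_mpoly_const_mult [simp]:
  "Poly_Mapping.lookup (mpoly_const c * p) m = (c::'a::semiring_0) * Poly_Mapping.lookup p m"
  unfolding mpoly_const_def mult_map_scale_conv_mult [symmetric]
  by (simp add: Poly_Mapping.map.rep_eq when_def)

lemma lookup_complex_mpoly [simp]: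
  "Poly_Mapping.lookup (complex_mpoly p) m = complex_of_real (Poly_Mapping.lookup p m)"
  by (simp add: complex_mpoly_def Poly_Mapping.map.rep_eq when_def)

text \<open>Terms outside the support are zero, so polynomials with different supports can be
  evaluated over one common index set.\<close>

lemma mpoly_eval_superset:
  assumes "finite S" "Poly_Mapping.keys p \<subseteq> S"
  shows "mpoly_eval p z =
    (\<Sum>m\<in>S. Poly_Mapping.lookup p m * (\<Prod>j\<in>UNIV. (z $ j) ^ Poly_Mapping.lookup m j))"
  unfolding mpoly_eval_def using assms
  by (intro sum.mono_neutral_left) (auto simp: in_keys_iff)

lemma mpoly_eval_add: "mpoly_eval (p + q) z = mpoly_eval p z + mpoly_eval q z"
proof -
  let ?S = "Poly_Mapping.keys p \<union> Poly_Mapping.keys q"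
  have "Poly_Mapping.keys (p + q) \<subseteq> ?S"
    by (rule Poly_Mapping.keys_add)
  then show ?thesis
    by (simp add: mpoly_eval_superset [of ?S] lookup_add distrib_right sum.distrib)
qed

lemma mpoly_eval_const_mult: "mpoly_eval (mpoly_const c * p) z = c * mpoly_eval p z"
proof -
  have "Poly_Mapping.keys (mpoly_const c * p) \<subseteq> Poly_Mapping.keys p"
    by (auto simp: in_keys_iff)
  then show ?thesis
    by (simp add: mpoly_eval_superset [of "Poly_Mapping.keys p"] sum_distrib_left mult.assoc)
qed

lemma complex_mpoly_add: "complex_mpoly (p + q) = complex_mpoly p + complex_mpoly q"
  by (rule poly_mapping_eqI) (simp add: lookup_add)

lemma complex_mpoly_const_mult:
  "complex_mpoly (mpoly_const c * p) = mpoly_const (complex_of_real c) * complex_mpoly p"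
  by (rule poly_mapping_eqI) simp

lemma mpoly_eval_complex_mpoly_cnj:
  "mpoly_eval (complex_mpoly p) (\<chi> j. cnj (z $ j)) = cnj (mpoly_eval (complex_mpoly p) z)"
  by (simp add: mpoly_eval_def)

text \<open>Uniqueness of base \<open>N\<close> digits: reduction modulo \<open>N\<close> recovers
  the lowest digit, and cancelling it leaves a shorter expansion.\<close>

lemma sum_base_representation_inj:
  fixes N :: nat
  assumes "\<And>i. i < k \<Longrightarrow> d i < N" "\<And>i. i < k \<Longrightarrow> e i < N"
    and "(\<Sum>i<k. d i * N ^ i) = (\<Sum>i<k. e i * N ^ i)" and "i < k"
  shows "d i = e i"
  using assms
proof (induction k arbitrary: d e i)
  case 0
  then show ?case by simp
next
  case (Suc k)
  have split: "(\<Sum>i<Suc k. c i * N ^ i) = c 0 + N * (\<Sum>i<k. c (Suc i) * N ^ i)" for c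
    by (simp add: sum.lessThan_Suc_shift sum_distrib_left mult_ac del: sum.lessThan_Suc)
  have eq: "d 0 + N * (\<Sum>i<k. d (Suc i) * N ^ i) = e 0 + N * (\<Sum>i<k. e (Suc i) * N ^ i)"
    using Suc.prems(3) unfolding split .
  have "d 0 < N" "e 0 < N"
    using Suc.prems(1,2) by auto
  with arg_cong [OF eq, of "\<lambda>x. x mod N"] have "d 0 = e 0"
    by simp
  moreover have "d (Suc l) = e (Suc l)" if "l < k" for l
  proof (rule Suc.IH [OF _ _ _ that])
    show "(\<Sum>i<k. d (Suc i) * N ^ i) = (\<Sum>i<k. e (Suc i) * N ^ i)"
      using eq \<open>d 0 = e 0\<close> \<open>d 0 < N\<close> by simp
  qed (use Suc.prems in auto)
  ultimately show ?case
    using \<open>i < Suc k\<close> by (cases i) auto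
qed

text \<open>Kronecker substitution: with distinct powers of a large \<open>N\<close> as weights, the
  weighted sum has the exponents as its base \<open>N\<close> digits.\<close>

lemma ex_weights_inj_on:
  fixes S :: "('n::finite \<Rightarrow>\<^sub>0 nat) set"
  assumes "finite S"
  obtains w :: "'n \<Rightarrow> nat"
  where "inj_on (\<lambda>m. \<Sum>j\<in>UNIV. w j * Poly_Mapping.lookup m j) S"
proof -
  obtain b :: "nat \<Rightarrow> 'n" where b: "bij_betw b {..<CARD('n)} UNIV"
    using ex_bij_betw_nat_finite [of "UNIV :: 'n set"] by (auto simp: atLeast0LessThan)
  define a where "a = the_inv_into {..<CARD('n)} b"
  have ab: "a (b i) = i" if "i < CARD('n)" for i
    using that b unfolding a_def by (simp add: bij_betw_def the_inv_into_f_f)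
  \<comment> \<open>\<open>Suc\<close> makes \<open>N\<close> strictly larger than every exponent in
    \<open>S\<close>, as digits require. For empty \<open>S\<close> the unspecified
    \<open>Max\<close> does no harm.\<close>
  define N where "N = Suc (Max ((\<lambda>(m, j). Poly_Mapping.lookup m j) ` (S \<times> UNIV)))"
  have N: "Poly_Mapping.lookup m j < N" if "m \<in> S" for m j
    unfolding N_def less_Suc_eq_le by (rule Max_ge) (use assms that in force)+
  have sum: "(\<Sum>j\<in>UNIV. N ^ a j * Poly_Mapping.lookup m j) =
      (\<Sum>i<CARD('n). Poly_Mapping.lookup m (b i) * N ^ i)" for m :: "'n \<Rightarrow>\<^sub>0 nat"
    by (subst sum.reindex_bij_betw [OF b, symmetric]) (simp add: ab mult.commute)
  show thesis
  proof (rule that, rule inj_onI)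
    fix m m' assume "m \<in> S" "m' \<in> S"
      and eq: "(\<Sum>j\<in>UNIV. N ^ a j * Poly_Mapping.lookup m j) =
        (\<Sum>j\<in>UNIV. N ^ a j * Poly_Mapping.lookup m' j)"
    then have digits: "Poly_Mapping.lookup m (b i) = Poly_Mapping.lookup m' (b i)" if "i < CARD('n)" for i
      using sum_base_representation_inj [of "CARD('n)" "\<lambda>i. Poly_Mapping.lookup m (b i)" N
          "\<lambda>i. Poly_Mapping.lookup m' (b i)" i] N that
      unfolding sum by blast
    show "m = m'"
    proof (rule poly_mapping_eqI)
      fix j
      obtain i where "i < CARD('n)" "j = b i"
        using b by (force simp: bij_betw_def)
      with digits show "Poly_Mapping.lookup m j = Poly_Mapping.lookup m' j"
        by simp
    qed
  qed
qed

text \<open>Substituting \<open>z\<^sub>j = i s\<^bsup>w j\<^esup>\<close> with weights separating the exponents reduces to one variable.\<close>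

lemma mpoly_eq_zero_if_eval_zero_on_upper:
  fixes p :: "('n::finite, complex) mpoly"
  assumes zero: "\<And>z. (\<forall>j. Im (z $ j) > 0) \<Longrightarrow> mpoly_eval p z = 0"
  shows "p = 0"
proof -
  let ?K = "Poly_Mapping.keys p"
  obtain w :: "'n \<Rightarrow> nat"
    where inj: "inj_on (\<lambda>m. \<Sum>j\<in>UNIV. w j * Poly_Mapping.lookup m j) ?K"
    using ex_weights_inj_on finite_keys by blast
  define e where "e m = (\<Sum>j\<in>UNIV. w j * Poly_Mapping.lookup m j)" for m
  \<comment> \<open>The powers of \<open>\<i>\<close> go into the coefficient; they are nonzero, so
    \<open>c m = 0\<close> forces the coefficient of \<open>p\<close> to vanish.\<close>
  define c where "c m = Poly_Mapping.lookup p m * (\<Prod>j\<in>UNIV. \<i> ^ Poly_Mapping.lookup m j)" for m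
  define P where "P = (\<Sum>m\<in>?K. monom (c m) (e m))"
  have "poly P (of_real s) = 0" if "s > 0" for s
  proof -
    have "poly P (of_real s) = mpoly_eval p (\<chi> j. \<i> * of_real s ^ w j)"
      by (simp add: P_def c_def e_def mpoly_eval_def poly_sum poly_monom power_mult_distrib
          prod.distrib power_sum power_mult mult.assoc)
    also have "\<dots> = 0"
      using that by (intro zero) (simp flip: of_real_power)
    finally show ?thesis .
  qed
  then have "of_real ` {0<..} \<subseteq> {x. poly P x = 0}"
    by auto
  moreover have "infinite (complex_of_real ` {0<..})"
    by (simp add: finite_image_iff inj_on_def infinite_Ioi)
  ultimately have "P = 0"
    using poly_roots_finite finite_subset by blast
  have "Poly_Mapping.lookup p m = 0" if "m \<in> ?K" for m
  proof -
    \<comment> \<open>By injectivity of \<open>e\<close> on the support no two monomials of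
      \<open>p\<close> merge in \<open>P\<close>.\<close>
    have "coeff P (e m) = (\<Sum>m'\<in>?K. if m' = m then c m' else 0)"
      unfolding P_def coeff_sum
      by (intro sum.cong) (use that inj in \<open>auto simp: inj_on_def e_def\<close>)
    also have "\<dots> = c m"
      using that by simp
    finally show ?thesis
      using \<open>P = 0\<close> by (simp add: c_def)
  qed
  then show ?thesis
    by (metis in_keys_iff keys_eq_empty equals0I)
qed

section \<open>Restriction to lines\<close>

text \<open>An actual \<open>poly\<close> makes the factorisation into linear factors and holomorphy
  available on complex lines.\<close>

definition line_poly :: "('n::finite, complex) mpoly \<Rightarrow> complex ^ 'n \<Rightarrow> complex ^ 'n \<Rightarrow> complex poly"
  where "line_poly p x y =
    (\<Sum>m\<in>Poly_Mapping.keys p.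
      smult (Poly_Mapping.lookup p m) (\<Prod>j\<in>UNIV. [:x $ j, y $ j:] ^ Poly_Mapping.lookup m j))"

lemma poly_line_poly: "poly (line_poly p x y) t = mpoly_eval p (\<chi> j. x $ j + t * y $ j)"
  by (simp add: line_poly_def mpoly_eval_def poly_sum poly_prod poly_power)

text \<open>Every root has imaginary part at most 0, hence is at least as close to
  \<open>cnj t\<close> as to \<open>t\<close>; the distances multiply over the linear
  factors.\<close>

lemma cmod_poly_cnj_le:
  fixes P :: "complex poly"
  assumes stable: "\<And>t. Im t > 0 \<Longrightarrow> poly P t \<noteq> 0" and "Im t > 0"
  shows "cmod (poly P (cnj t)) \<le> cmod (poly P t)"
proof -
  obtain r where r: "smult (lead_coeff P) (\<Prod>i<degree P. [:- r i, 1:]) = P"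
    by (rule complex_poly_decompose')
  have ev: "poly P s = lead_coeff P * (\<Prod>i<degree P. s - r i)" for s
    by (subst r [symmetric]) (simp add: poly_prod)
  have "cmod (cnj t - r i) \<le> cmod (t - r i)" if "i < degree P" for i
  proof -
    have "poly P (r i) = 0"
      using that by (auto simp: ev)
    with stable have "Im (r i) \<le> 0"
      using not_le by blast
    then have "\<bar>- Im t - Im (r i)\<bar> \<le> \<bar>Im t - Im (r i)\<bar>"
      using \<open>Im t > 0\<close> by arith
    then have "(- Im t - Im (r i))\<^sup>2 \<le> (Im t - Im (r i))\<^sup>2"
      by (simp only: abs_le_square_iff)
    then show ?thesis
      by (simp add: cmod_def)
  qed
  then show ?thesis
    unfolding ev norm_mult prod_norm [symmetric] by (intro mult_left_mono prod_mono) auto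
qed

text \<open>The points \<open>z\<close> and its conjugate are the values at \<open>\<i>\<close> and
  \<open>cnj \<i>\<close> of the line with real base point \<open>Re z\<close> and positive
  direction \<open>Im z\<close>, which maps the upper half plane into the domain of
  stability.\<close>

lemma stable_cmod_cnj_le:
  assumes "p \<in> stable_mpolys" and z: "\<And>j. Im (z $ j) > 0"
  shows "cmod (mpoly_eval p (\<chi> j. cnj (z $ j))) \<le> cmod (mpoly_eval p z)"
proof -
  define P where "P = line_poly p (\<chi> j. of_real (Re (z $ j))) (\<chi> j. of_real (Im (z $ j)))"
  have "cmod (poly P (cnj \<i>)) \<le> cmod (poly P \<i>)"
  proof (rule cmod_poly_cnj_le)
    show "poly P t \<noteq> 0" if "Im t > 0" for t
      using assms that by (simp add: P_def poly_line_poly stable_mpolys_def)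
  qed simp
  moreover have "(\<chi> j. of_real (Re (z $ j)) + \<i> * of_real (Im (z $ j))) = z"
    by (simp add: vec_eq_iff complex_eq_iff)
  moreover have "(\<chi> j. of_real (Re (z $ j)) + cnj \<i> * of_real (Im (z $ j))) = (\<chi> j. cnj (z $ j))"
    by (simp add: vec_eq_iff complex_eq_iff)
  ultimately show ?thesis
    by (simp add: P_def poly_line_poly)
qed

lemma convex_upper: "convex {z :: complex ^ 'n::finite. \<forall>j. Im (z $ j) > 0}"
proof (intro convexI CollectI allI)
  fix x y :: "complex ^ 'n" and u v :: real and j
  assume "x \<in> {z. \<forall>j. Im (z $ j) > 0}" "y \<in> {z. \<forall>j. Im (z $ j) > 0}"
    and "0 \<le> u" "0 \<le> v" "u + v = 1"
  moreover from this have "u > 0 \<or> v > 0"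
    by linarith
  ultimately show "Im ((u *\<^sub>R x + v *\<^sub>R y) $ j) > 0"
    by (auto simp: less_imp_le add_pos_nonneg add_nonneg_pos)
qed

section \<open>Proper position and real combinations\<close>

text \<open>Only the cross terms survive. In particular the two moduli agree exactly when
  \<open>b * cnj a\<close> is real.\<close>

lemma cmod_add_ii_diff:
  "(cmod (b + \<i> * a))\<^sup>2 - (cmod (b - \<i> * a))\<^sup>2 = 4 * Im (b * cnj a)"
  unfolding cmod_power2 by (simp add: power2_eq_square algebra_simps)

section \<open>From proper position to stable real combinations\<close>

lemma proper_position_imp_stable_combination:
  fixes f g :: "('n::finite, real) mpoly"
  assumes "f \<lless> g"
  shows "mpoly_const \<alpha> * f + mpoly_const \<beta> * g \<in> real_stable_mpolys \<union> {0}"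
proof (rule ccontr)
  define F where "F = mpoly_eval (complex_mpoly f)"
  define G where "G = mpoly_eval (complex_mpoly g)"
  define h where "h = complex_mpoly g + mpoly_const \<i> * complex_mpoly f"
  define k where "k = complex_mpoly g + mpoly_const (-\<i>) * complex_mpoly f"
  define q where "q = mpoly_const \<alpha> * f + mpoly_const \<beta> * g"
  have h: "mpoly_eval h z = G z + \<i> * F z" for z
    by (simp add: h_def F_def G_def mpoly_eval_add mpoly_eval_const_mult)
  have k: "mpoly_eval k z = G z - \<i> * F z" for z
    by (simp add: k_def F_def G_def mpoly_eval_add mpoly_eval_const_mult)
  have q: "mpoly_eval (complex_mpoly q) z = \<alpha> * F z + \<beta> * G z" for z
    by (simp add: q_def F_def G_def complex_mpoly_add complex_mpoly_const_mult mpoly_eval_add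
        mpoly_eval_const_mult)
  have stable: "h \<in> stable_mpolys"
    using assms by (simp add: proper_position_def h_def)
  \<comment> \<open>The coefficients of \<open>f\<close> and \<open>g\<close> are real, so the bound
    for \<open>h\<close> at conjugate points becomes a bound of \<open>k\<close> by
    \<open>h\<close>.\<close>
  have "mpoly_eval h (\<chi> j. cnj (z $ j)) = cnj (mpoly_eval k z)" for z
    by (simp add: h k) (simp add: F_def G_def mpoly_eval_complex_mpoly_cnj)
  then have le: "cmod (mpoly_eval k z) \<le> cmod (mpoly_eval h z)" if "\<forall>j. Im (z $ j) > 0" for z
    using stable_cmod_cnj_le [OF stable, of z] that by simp
  have h_nz: "mpoly_eval h z \<noteq> 0" if "\<forall>j. Im (z $ j) > 0" for z
    using stable that by (simp add: stable_mpolys_def)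
  assume "\<not> mpoly_const \<alpha> * f + mpoly_const \<beta> * g \<in> real_stable_mpolys \<union> {0}"
  then have "q \<noteq> 0" and "complex_mpoly q \<notin> stable_mpolys"
    by (auto simp: q_def real_stable_mpolys_def)
  then obtain z0 where z0: "\<forall>j. Im (z0 $ j) > 0" and q0: "mpoly_eval (complex_mpoly q) z0 = 0"
    by (auto simp: stable_mpolys_def)
  have nz: "\<alpha> \<noteq> 0 \<or> \<beta> \<noteq> 0"
    using \<open>q \<noteq> 0\<close> by (auto simp: q_def mpoly_const_def)
  \<comment> \<open>A nontrivial real relation between \<open>F z0\<close> and \<open>G z0\<close>
    makes \<open>G z0 * cnj (F z0)\<close> real.\<close>
  have mod1: "cmod (mpoly_eval k z0) = cmod (mpoly_eval h z0)"
  proof -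
    have rel: "\<alpha> * F z0 + \<beta> * G z0 = 0"
      using q0 q by simp
    have "Im (G z0 * cnj (F z0)) = 0"
    proof (cases "\<beta> = 0")
      case True
      with rel nz show ?thesis by simp
    next
      case False
      with rel have "G z0 = of_real (- \<alpha> / \<beta>) * F z0"
        by (simp add: field_simps add_eq_0_iff)
      then show ?thesis
        by (simp add: mult.assoc complex_mult_cnj del: of_real_divide of_real_minus)
    qed
    then have "(cmod (mpoly_eval k z0))\<^sup>2 = (cmod (mpoly_eval h z0))\<^sup>2"
      using cmod_add_ii_diff [of "G z0" "F z0"] by (simp add: h k)
    then show ?thesis
      by simp
  qed
  have "mpoly_eval (complex_mpoly q) w = 0" if w: "\<forall>j. Im (w $ j) > 0" for w
  proof -
    \<comment> \<open>The complex line through \<open>z0\<close> and \<open>w\<close> reduces the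
      claim to the maximum principle in one variable; \<open>S\<close> is convex because
      \<open>line\<close> is affine.\<close>
    define line where "line s = (\<chi> j. z0 $ j + s * (w - z0) $ j)" for s
    define S where "S = {s. \<forall>j. Im (line s $ j) > 0}"
    define \<phi> where "\<phi> s = mpoly_eval k (line s) / mpoly_eval h (line s)" for s
    have line01: "line 0 = z0" "line 1 = w"
      by (simp_all add: line_def vec_eq_iff)
    have "S = (\<Inter>j. {s. 0 < Im (line s $ j)})"
      by (auto simp: S_def)
    moreover have "open {s. 0 < Im (line s $ j)}" for j
      unfolding line_def by (simp del: times_complex.sel plus_complex.sel)
        (intro open_Collect_less continuous_intros)
    ultimately have "open S"
      by auto
    have "convex S"
    proof (rule convexI)
      fix s t and u v :: real
      assume st: "s \<in> S" "t \<in> S" and uv: "0 \<le> u" "0 \<le> v" "u + v = 1"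
      have "line (u *\<^sub>R s + v *\<^sub>R t) $ j = (u *\<^sub>R line s + v *\<^sub>R line t) $ j" for j
        using uv(3) by (simp add: line_def algebra_simps) (metis scaleR_left_distrib scaleR_one)
      moreover have "u *\<^sub>R line s + v *\<^sub>R line t \<in> {z. \<forall>j. Im (z $ j) > 0}"
        using st uv by (intro convexD [OF convex_upper]) (auto simp: S_def)
      ultimately show "u *\<^sub>R s + v *\<^sub>R t \<in> S"
        by (simp add: S_def)
    qed
    have mem: "0 \<in> S" "1 \<in> S"
      using z0 w by (simp_all add: S_def line01)
    have "\<phi> constant_on S"
    proof (rule maximum_modulus_principle [where U = S])
      have "(\<lambda>s. poly (line_poly k z0 (w - z0)) s / poly (line_poly h z0 (w - z0)) s) holomorphic_on S"
        using h_nz by (intro holomorphic_intros) (simp add: poly_line_poly S_def line_def)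
      then show "\<phi> holomorphic_on S"
        by (simp add: \<phi>_def [abs_def] poly_line_poly line_def)
      show "connected S"
        using \<open>convex S\<close> by (rule convex_connected)
      \<comment> \<open>The bound \<open>le\<close> gives modulus at most 1 on \<open>S\<close>, and
        \<open>mod1\<close> gives modulus 1 at the interior point 0.\<close>
      show "cmod (\<phi> s) \<le> cmod (\<phi> 0)" if "s \<in> S" for s
        using that le h_nz z0 mod1
        by (simp add: \<phi>_def S_def line01 norm_divide divide_le_eq_1)
    qed (use \<open>open S\<close> mem in auto)
    then have "\<phi> 1 = \<phi> 0"
      using mem by (auto simp: constant_on_def)
    then have "mpoly_eval k w * mpoly_eval h z0 = mpoly_eval k z0 * mpoly_eval h w"
      using h_nz z0 w by (simp add: \<phi>_def line01 frac_eq_eq)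
    \<comment> \<open>Equal quotients mean that the pairs \<open>(F, G)\<close> at \<open>w\<close>
      and \<open>z0\<close> are proportional. The pair at \<open>z0\<close> is nonzero since
      \<open>h\<close> does not vanish there, so the relation passes to \<open>w\<close>.\<close>
    then have "F w * G z0 = F z0 * G w"
      by (simp add: h k algebra_simps)
    moreover have "\<alpha> * F z0 + \<beta> * G z0 = 0"
      using q0 q by simp
    ultimately have "F z0 * (\<alpha> * F w + \<beta> * G w) = 0" "G z0 * (\<alpha> * F w + \<beta> * G w) = 0"
      by algebra+
    moreover have "F z0 \<noteq> 0 \<or> G z0 \<noteq> 0"
      using h_nz [OF z0] by (auto simp: h)
    ultimately show ?thesis
      by (auto simp: q)
  qed
  then have "complex_mpoly q = 0"
    by (rule mpoly_eq_zero_if_eval_zero_on_upper)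
  then have "q = 0"
    by (metis lookup_complex_mpoly lookup_zero of_real_eq_0_iff poly_mapping_eqI)
  with \<open>q \<noteq> 0\<close> show False ..
qed

section \<open>From stable real combinations to proper position\<close>

lemma proper_position_if_Im_pos:
  assumes "\<And>z. (\<forall>j. Im (z $ j) > 0) \<Longrightarrow>
    Im (mpoly_eval (complex_mpoly g) z * cnj (mpoly_eval (complex_mpoly f) z)) > 0"
  shows "f \<lless> g"
  unfolding proper_position_def stable_mpolys_def
proof (intro CollectI allI impI)
  fix z :: "complex ^ 'a" assume "\<forall>j. Im (z $ j) > 0"
  \<comment> \<open>The squared modulus exceeds that of \<open>g - \<i> f\<close> at
    \<open>z\<close>, which is nonnegative.\<close>
  then have "(cmod (mpoly_eval (complex_mpoly g) z + \<i> * mpoly_eval (complex_mpoly f) z))\<^sup>2 > 0"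
    using assms [of z] cmod_add_ii_diff
    by (smt (verit) zero_le_power2)
  then show "mpoly_eval (complex_mpoly g + mpoly_const \<i> * complex_mpoly f) z \<noteq> 0"
    by (auto simp: mpoly_eval_add mpoly_eval_const_mult)
qed

text \<open>Here \<open>g + \<i> f\<close> is \<open>(1 + \<i> c) g\<close>, with a nonzero factor
  for real \<open>c\<close>. This settles the dependent case, where \<open>Im (g cnj f)\<close>
  vanishes identically and has no sign.\<close>

lemma proper_position_if_real_multiple:
  assumes "g \<in> real_stable_mpolys" "f = mpoly_const c * g"
  shows "f \<lless> g"
  unfolding proper_position_def stable_mpolys_def
proof (intro CollectI allI impI)
  fix z :: "complex ^ 'a" assume "\<forall>j. Im (z $ j) > 0"
  then have "mpoly_eval (complex_mpoly g) z \<noteq> 0"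
    using assms(1) by (simp add: real_stable_mpolys_def stable_mpolys_def)
  moreover have "1 + \<i> * of_real c \<noteq> 0"
    by (simp add: complex_eq_iff)
  moreover have "mpoly_eval (complex_mpoly g + mpoly_const \<i> * complex_mpoly f) z =
      (1 + \<i> * of_real c) * mpoly_eval (complex_mpoly g) z"
    by (simp add: assms(2) complex_mpoly_const_mult mpoly_eval_add mpoly_eval_const_mult distrib_right)
  ultimately show "mpoly_eval (complex_mpoly g + mpoly_const \<i> * complex_mpoly f) z \<noteq> 0"
    by simp
qed

lemma stable_combinations_imp_proper_position:
  fixes f g :: "('n::finite, real) mpoly"
  assumes comb: "\<And>\<alpha> \<beta>. mpoly_const \<alpha> * f + mpoly_const \<beta> * g \<in> real_stable_mpolys \<union> {0}"
    and "\<not> (f = g \<and> g = 0)"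
  shows "f \<lless> g \<or> g \<lless> f"
proof -
  define F where "F = mpoly_eval (complex_mpoly f)"
  define G where "G = mpoly_eval (complex_mpoly g)"
  have f: "f \<in> real_stable_mpolys \<union> {0}" and g: "g \<in> real_stable_mpolys \<union> {0}"
    using comb [of 1 0] comb [of 0 1] by (simp_all add: mpoly_const_def)
  show ?thesis
  proof (cases "\<exists>c. f = mpoly_const c * g \<or> g = mpoly_const c * f")
    case True
    then obtain c where c: "f = mpoly_const c * g \<or> g = mpoly_const c * f" ..
    then show ?thesis
    proof
      assume fg: "f = mpoly_const c * g"
      with assms(2) have "g \<noteq> 0"
        by auto
      with g fg show ?thesis
        using proper_position_if_real_multiple by blast
    next
      assume gf: "g = mpoly_const c * f"
      with assms(2) have "f \<noteq> 0"
        by auto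
      with f gf show ?thesis
        using proper_position_if_real_multiple by blast
    qed
  next
    case False
    define H where "H = {z :: complex ^ 'n. \<forall>j. Im (z $ j) > 0}"
    have "f \<noteq> 0"
    proof
      assume "f = 0"
      then have "f = mpoly_const 0 * g"
        by (simp add: mpoly_const_def)
      with False show False by blast
    qed
    have F_nz: "F z \<noteq> 0" if "z \<in> H" for z
      using f \<open>f \<noteq> 0\<close> that by (simp add: F_def H_def real_stable_mpolys_def stable_mpolys_def)
    have G_nz: "G z \<noteq> of_real c * F z" if "z \<in> H" for z c
    proof -
      \<comment> \<open>Since \<open>f\<close> and \<open>g\<close> are not proportional, this
        combination is nonzero and therefore stable.\<close>
      have "mpoly_const (-c) * f + mpoly_const 1 * g \<noteq> 0"
      proof
        assume "mpoly_const (-c) * f + mpoly_const 1 * g = 0"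
        then have "Poly_Mapping.lookup (mpoly_const (-c) * f + mpoly_const 1 * g) m = 0" for m
          by simp
        then have "g = mpoly_const c * f"
          by (intro poly_mapping_eqI) (simp add: lookup_add)
        with False show False by blast
      qed
      with comb [of "-c" 1] have "mpoly_const (-c) * f + mpoly_const 1 * g \<in> real_stable_mpolys"
        by blast
      then have "mpoly_eval (complex_mpoly (mpoly_const (-c) * f + mpoly_const 1 * g)) z \<noteq> 0"
        using that unfolding real_stable_mpolys_def stable_mpolys_def H_def by blast
      then show ?thesis
        by (simp add: F_def G_def complex_mpoly_add complex_mpoly_const_mult mpoly_eval_add
            mpoly_eval_const_mult)
    qed
    define \<psi> where "\<psi> z = Im (G z * cnj (F z))" for z
    have \<psi>_nz: "\<psi> z \<noteq> 0" if "z \<in> H" for z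
    proof
      assume "\<psi> z = 0"
      \<comment> \<open>A real \<open>G z * cnj (F z)\<close> would make \<open>G z\<close> a real
        multiple of \<open>F z\<close>, with factor obtained on dividing by the squared modulus of
        \<open>F z\<close>.\<close>
      then have "G z * cnj (F z) = of_real (Re (G z * cnj (F z)))"
        by (simp add: \<psi>_def complex_eq_iff)
      then have "G z * (F z * cnj (F z)) = of_real (Re (G z * cnj (F z))) * F z"
        by (metis mult.assoc mult.commute)
      then have "G z = of_real (Re (G z * cnj (F z)) / (cmod (F z))\<^sup>2) * F z"
        using F_nz [OF that] by (simp add: complex_norm_square [symmetric] field_simps)
      with G_nz [OF that] show False by blast
    qed
    have "continuous_on H \<psi>"
      unfolding \<psi>_def F_def G_def mpoly_eval_def by (intro continuous_intros)
    moreover have "connected H"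
      unfolding H_def by (rule convex_connected [OF convex_upper])
    ultimately have conn: "connected (\<psi> ` H)"
      by (rule connected_continuous_image)
    have sign: "(\<forall>z\<in>H. \<psi> z > 0) \<or> (\<forall>z\<in>H. \<psi> z < 0)"
    proof (rule ccontr)
      assume "\<not> ?thesis"
      then obtain u v where "u \<in> H" "v \<in> H" "\<psi> u \<le> 0" "0 \<le> \<psi> v"
        by (meson not_le)
      then have "0 \<in> \<psi> ` H"
        using connectedD_interval [OF conn] by blast
      with \<psi>_nz show False by auto
    qed
    \<comment> \<open>Exchanging \<open>f\<close> and \<open>g\<close> reverses the sign, so
      negative \<open>\<psi>\<close> yields \<open>g \<lless> f\<close>.\<close>
    have "\<psi> z = - Im (F z * cnj (G z))" for z
      by (simp add: \<psi>_def)
    with sign have "(\<forall>z\<in>H. Im (G z * cnj (F z)) > 0) \<or> (\<forall>z\<in>H. Im (F z * cnj (G z)) > 0)"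
      by (metis \<psi>_def neg_less_0_iff_less minus_minus)
    then show ?thesis
      using proper_position_if_Im_pos [of g f] proper_position_if_Im_pos [of f g]
      unfolding F_def G_def H_def by blast
  qed
qed

theorem theorem1p6:
  fixes f g :: "('n::finite, real) mpoly"
  shows "(\<forall>\<alpha> \<beta> :: real. mpoly_const \<alpha> * f + mpoly_const \<beta> * g \<in> real_stable_mpolys \<union> {0})
     \<longleftrightarrow> f \<lless> g \<or> g \<lless> f \<or> (f = g \<and> g = 0)"
proof
  assume "\<forall>\<alpha> \<beta> :: real. mpoly_const \<alpha> * f + mpoly_const \<beta> * g \<in> real_stable_mpolys \<union> {0}"
  then show "f \<lless> g \<or> g \<lless> f \<or> (f = g \<and> g = 0)"
    using stable_combinations_imp_proper_position by blast
next
  assume "f \<lless> g \<or> g \<lless> f \<or> (f = g \<and> g = 0)"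
  then show "\<forall>\<alpha> \<beta> :: real. mpoly_const \<alpha> * f + mpoly_const \<beta> * g \<in> real_stable_mpolys \<union> {0}"
    \<comment> \<open>The case \<open>g \<lless> f\<close> follows by exchanging
      \<open>\<alpha>\<close> and \<open>\<beta>\<close> along with the polynomials.\<close>
    using proper_position_imp_stable_combination [of f g]
      proper_position_imp_stable_combination [of g f]
    by (metis Un_iff add.commute add_0 mult_zero_right singletonI)
qed

end
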